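(* Let $\mathcal{I}=[0,\infty)$ and let $F:\mathcal{I}^2\to\mathcal{I}$ be a sufficiently smooth map that is strictly increasing in its first argument and strictly decreasing in its second argument. Assume $\bar x=1$ is a unique fixed point of $F$ and $\|\nabla F(1,1)\|_1<1$ (i.e. $\bar x=1$ is strongly locally asymptotically stable). Let $$\mathcal{R}=\{(x,y)\in\mathcal{I}^2:\ \min\{x,y\}<F(x,y)<\max\{x,y\}\}\cup\{(1,1)\},$$ and let $\phi:\mathcal{I}\to\mathcal{I}$ be a decreasing and differentiable map such that $(x,\phi(x))\in\mathcal{R}$ for all $x$. Suppose $\bar x=1$ is locally asymptotically stable under $\phi$ and $(x,\phi^{-1}(x))\in\mathcal{R}$ for all $x$ in the domain of $\phi^{-1}$. If $g(x)=F(\phi(x),x)$ has no $2$-cycle, then $\bar x$ is globally asymptotically stable for $F$.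
   Context: A fixed point of $F$ is $\bar x$ with $F(\bar x,\bar x)=\bar x$; the dynamics of $F$ is that of $x_{n+1}=F(x_n,x_{n-1})$. Here $\|\nabla F(1,1)\|_1=|F_x(1,1)|+|F_y(1,1)|$. Locally asymptotically stable (LAS): for $F$, the eigenvalues of $\begin{bmatrix}F_x(1,1)&F_y(1,1)\\1&0\end{bmatrix}$ lie in the open unit disk; for a one-dimensional map $\phi$ with $\phi(1)=1$, $|\phi'(1)|<1$. Globally asymptotically stable (GAS) means LAS and every solution with initial conditions in $\mathcal{I}$ converges to the fixed point. A $2$-cycle of $g$ is a pair $x_0\neq x_1$ with $g(x_0)=x_1$, $g(x_1)=x_0$. Standing assumption: the curves $y=F(x,y)$ and $x=F(x,y)$ have a unique intersection in the interior of the positive quadrant, namely $(1,1)$. *)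

theory Defs
  imports "HOL-Analysis.Analysis" "Jordan_Normal_Form.Char_Poly"
begin

abbreviation \<I> :: "real set" where
  "\<I> \<equiv> {0..}"

text \<open>
  Smoothness of a map on a set that need not be open: the derivative is taken within the set, so
  it is one-sided on the boundary of the quadrant. ``Sufficiently smooth'' is read as
  \<open>C\<^sup>1\<close>; a map of any higher smoothness class is in particular \<open>C\<^sup>1\<close>.
\<close>

definition C1_on :: "('a::real_normed_vector \<Rightarrow> 'b::real_normed_vector) \<Rightarrow> 'a set \<Rightarrow> bool" where
  "C1_on f S \<longleftrightarrow> (\<exists>f' :: 'a \<Rightarrow> 'a \<Rightarrow>\<^sub>L 'b.
     (\<forall>p\<in>S. (f has_derivative blinfun_apply (f' p)) (at p within S)) \<and> continuous_on S f')"

definition partial_x :: "(real \<times> real \<Rightarrow> real) \<Rightarrow> real \<times> real \<Rightarrow> real" where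
  "partial_x F p = deriv (\<lambda>s. F (s, snd p)) (fst p)"

definition partial_y :: "(real \<times> real \<Rightarrow> real) \<Rightarrow> real \<times> real \<Rightarrow> real" where
  "partial_y F p = deriv (\<lambda>s. F (fst p, s)) (snd p)"

definition grad_norm1 :: "(real \<times> real \<Rightarrow> real) \<Rightarrow> real \<times> real \<Rightarrow> real" where
  "grad_norm1 F p = \<bar>partial_x F p\<bar> + \<bar>partial_y F p\<bar>"

definition jacobian :: "(real \<times> real \<Rightarrow> real) \<Rightarrow> real \<Rightarrow> complex mat" where
  "jacobian F a = mat_of_rows_list 2
     [[of_real (partial_x F (a, a)), of_real (partial_y F (a, a))],
      [1,                            0]]"

definition LAS :: "(real \<times> real \<Rightarrow> real) \<Rightarrow> real \<Rightarrow> bool" where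
  "LAS F a \<longleftrightarrow> F (a, a) = a \<and> (\<forall>l. eigenvalue (jacobian F a) l \<longrightarrow> cmod l < 1)"

definition LAS_1d :: "(real \<Rightarrow> real) \<Rightarrow> real \<Rightarrow> bool" where
  "LAS_1d \<phi> a \<longleftrightarrow> \<phi> a = a \<and> \<bar>deriv \<phi> a\<bar> < 1"

text \<open>
  Indices are shifted by one, so that the initial conditions \<open>x\<^sub>-\<^sub>1, x\<^sub>0\<close> are \<open>x 0, x 1\<close>.
\<close>

definition is_solution :: "(real \<times> real \<Rightarrow> real) \<Rightarrow> (nat \<Rightarrow> real) \<Rightarrow> bool" where
  "is_solution F x \<longleftrightarrow>
     x 0 \<in> \<I> \<and> x 1 \<in> \<I> \<and> (\<forall>n. x (Suc (Suc n)) = F (x (Suc n), x n))"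

definition GAS :: "(real \<times> real \<Rightarrow> real) \<Rightarrow> real \<Rightarrow> bool" where
  "GAS F a \<longleftrightarrow> LAS F a \<and> (\<forall>x. is_solution F x \<longrightarrow> x \<longlonglongrightarrow> a)"

definition region :: "(real \<times> real \<Rightarrow> real) \<Rightarrow> (real \<times> real) set" where
  "region F = {(x, y) \<in> \<I> \<times> \<I>. min x y < F (x, y) \<and> F (x, y) < max x y} \<union> {(1, 1)}"

definition has_2_cycle :: "(real \<Rightarrow> real) \<Rightarrow> bool" where
  "has_2_cycle g \<longleftrightarrow> (\<exists>x0\<in>\<I>. \<exists>x1\<in>\<I>. x0 \<noteq> x1 \<and> g x0 = x1 \<and> g x1 = x0)"

end

theory Submission
  imports Defs
begin

text \<open>
  For \<open>t < 1\<close> consider the square \<open>[t, \<phi>(t)]\<^sup>2\<close>. As \<open>F\<close> increases in its first and decreases in its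
  second argument, its extreme values on the square are taken at two opposite corners: the minimum
  is \<open>F(t, \<phi>(t))\<close> and the maximum is \<open>F(\<phi>(t), t)\<close>. Membership of the graphs of \<open>\<phi>\<close> and
  \<open>\<phi>\<^sup>-\<^sup>1\<close> in the region implies that the minimum exceeds \<open>t\<close> and the maximum is below
  \<open>\<phi>(t)\<close>, so that \<open>F\<close> maps the square into the interior of \<open>[t, \<phi>(t)]\<close>. By continuity, a
  solution that is eventually in \<open>[t, \<phi>(t)]\<close> is then eventually in \<open>[t + \<delta>, \<phi>(t + \<delta>)]\<close> for some
  \<open>\<delta> > 0\<close>, and the supremum of all \<open>t\<close> whose interval absorbs the solution can only be \<open>1\<close>. These
  intervals shrink to \<open>{1}\<close>, so every solution that is eventually in \<open>[0, \<phi>(0)]\<close> converges to \<open>1\<close>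
  (lemma \<open>nested_boxes_tendsto\<close>).

  Every solution does get there. Since \<open>F(\<phi>(0), 0) < \<phi>(0)\<close>, a solution that reaches
  \<open>[0, \<phi>(0)]\<close> by a step of the recursion never leaves this interval again. If all terms
  stayed above \<open>\<phi>(0) > 1\<close>, then \<open>\<phi>(x\<^sub>n) < 1 < x\<^sub>n\<^sub>-\<^sub>1\<close> and hence \<open>x\<^sub>n\<^sub>+\<^sub>1 = F(x\<^sub>n, x\<^sub>n\<^sub>-\<^sub>1) < F(x\<^sub>n, \<phi>(x\<^sub>n)) < x\<^sub>n\<close>; the solution
  would decrease to a fixed point above \<open>1\<close>, but there is none (lemma \<open>solution_enters_box\<close>).

  The eigenvalues at the fixed point are the roots of \<open>\<lambda>\<^sup>2 = a \<lambda> + b\<close> with \<open>\<bar>a\<bar> + \<bar>b\<bar> < 1\<close>; a root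
  with \<open>\<bar>\<lambda>\<bar> \<ge> 1\<close> would satisfy \<open>\<bar>\<lambda>\<bar>\<^sup>2 \<le> (\<bar>a\<bar> + \<bar>b\<bar>) \<bar>\<lambda>\<bar> < \<bar>\<lambda>\<bar>\<close> (lemma \<open>quadratic_root_norm_less_1\<close>).
\<close>

lemma quadratic_root_norm_less_1:
  fixes l a b :: complex
  assumes "l * l = a * l + b" and "cmod a + cmod b < 1"
  shows "cmod l < 1"
proof (rule ccontr)
  assume "\<not> cmod l < 1"
  hence l1: "1 \<le> cmod l" by simp
  have "cmod l * cmod l = cmod (a * l + b)"
    by (metis assms(1) norm_mult)
  also have "\<dots> \<le> cmod a * cmod l + cmod b"
    by (metis norm_mult norm_triangle_ineq)
  also have "\<dots> \<le> cmod a * cmod l + cmod b * cmod l"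
    using mult_left_mono[OF l1, of "cmod b"] by simp
  also have "\<dots> = (cmod a + cmod b) * cmod l" by (simp add: algebra_simps)
  also have "\<dots> < 1 * cmod l"
    using assms(2) l1 by (intro mult_strict_right_mono) auto
  finally show False using mult_left_mono[OF l1, of "cmod l"] by simp
qed

lemma LAS_if_grad_norm1:
  assumes "F (a, a) = a" and "grad_norm1 F (a, a) < 1"
  shows "LAS F a"
  unfolding LAS_def
proof (intro conjI allI impI)
  fix l assume "eigenvalue (jacobian F a) l"
  then obtain v where ev: "eigenvector (jacobian F a) v l"
    unfolding eigenvalue_def by blast
  define p q where "p = complex_of_real (partial_x F (a, a))"
    and "q = complex_of_real (partial_y F (a, a))"
  have J: "jacobian F a = mat_of_rows_list 2 [[p, q], [1, 0]]"
    by (simp add: jacobian_def p_def q_def)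
  have dim: "dim_row (jacobian F a) = 2" "dim_col (jacobian F a) = 2"
    by (simp_all add: J mat_of_rows_list_def)
  have v: "v \<in> carrier_vec 2" "v \<noteq> 0\<^sub>v 2" and eq: "jacobian F a *\<^sub>v v = l \<cdot>\<^sub>v v"
    using ev by (auto simp: eigenvector_def dim)
  have dv: "dim_vec v = 2" using v(1) by simp
  have 0: "p * vec_index v 0 + q * vec_index v 1 = l * vec_index v 0"
    using arg_cong[OF eq, of "\<lambda>w. vec_index w 0"] dv
    by (simp add: J mat_of_rows_list_def scalar_prod_def numeral_2_eq_2)
  have 1: "vec_index v 0 = l * vec_index v 1"
    using arg_cong[OF eq, of "\<lambda>w. vec_index w 1"] dv
    by (simp add: J mat_of_rows_list_def scalar_prod_def numeral_2_eq_2)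
  have "vec_index v 1 \<noteq> 0"
  proof
    assume "vec_index v 1 = 0"
    hence "v = 0\<^sub>v 2"
      using 1 dv by (intro eq_vecI) (auto simp: less_2_cases_iff)
    thus False using v(2) by simp
  qed
  moreover have "(l * l) * vec_index v 1 = (p * l + q) * vec_index v 1"
    using 0 unfolding 1 by (simp add: algebra_simps)
  ultimately have "l * l = p * l + q" by simp
  moreover have "cmod p + cmod q < 1"
    using assms(2) by (simp add: grad_norm1_def p_def q_def)
  ultimately show "cmod l < 1" by (rule quadratic_root_norm_less_1)
qed (rule assms(1))

lemma C1_on_imp_continuous_on: "C1_on f S \<Longrightarrow> continuous_on S f"
  unfolding C1_on_def by (auto intro: has_derivative_continuous_on)

lemma is_solution_nonneg:
  assumes "F \<in> \<I> \<times> \<I> \<rightarrow> \<I>" and "is_solution F x"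
  shows "0 \<le> x n"
proof (induction n rule: less_induct)
  case (less n)
  consider "n = 0" | "n = 1" | k where "n = Suc (Suc k)"
    by (metis One_nat_def not0_implies_Suc)
  thus ?case
  proof cases
    case 3
    have "(x (Suc k), x k) \<in> \<I> \<times> \<I>" using less.IH 3 by simp
    hence "F (x (Suc k), x k) \<in> \<I>" using assms(1) by blast
    thus ?thesis using assms(2) 3 by (simp add: is_solution_def)
  qed (use assms(2) in \<open>auto simp: is_solution_def\<close>)
qed

text \<open>
  The supremum of the parameters \<open>t\<close> whose interval \<open>[t, \<phi> t]\<close> absorbs the solution is \<open>1\<close>: below
  \<open>1\<close>, the strict inequalities at the corners leave room to enlarge \<open>t\<close>.
\<close>

lemma nested_boxes_tendsto:
  fixes F :: "real \<times> real \<Rightarrow> real" and \<phi> :: "real \<Rightarrow> real" and x :: "nat \<Rightarrow> real"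
  assumes cont_F: "continuous_on (\<I> \<times> \<I>) F"
    and mono_F: "\<And>x x' y y'. 0 \<le> x \<Longrightarrow> x \<le> x' \<Longrightarrow> 0 \<le> y' \<Longrightarrow> y' \<le> y \<Longrightarrow> F (x, y) \<le> F (x', y')"
    and cont_\<phi>: "continuous_on \<I> \<phi>" and \<phi>_maps: "\<phi> \<in> \<I> \<rightarrow> \<I>"
    and anti_\<phi>: "antimono_on \<I> \<phi>" and \<phi>_1: "\<phi> 1 = 1"
    and lower_corner: "\<And>t. 0 \<le> t \<Longrightarrow> t < 1 \<Longrightarrow> t < F (t, \<phi> t)"
    and upper_corner: "\<And>t. 0 \<le> t \<Longrightarrow> t < 1 \<Longrightarrow> F (\<phi> t, t) < \<phi> t"
    and rec: "\<And>n. x (Suc (Suc n)) = F (x (Suc n), x n)"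
    and start: "eventually (\<lambda>n. x n \<in> {0..\<phi> 0}) sequentially"
  shows "x \<longlonglongrightarrow> 1"
proof -
  define T where "T = {t \<in> {0..1}. eventually (\<lambda>n. x n \<in> {t..\<phi> t}) sequentially}"
  have T0: "0 \<in> T" using start unfolding T_def by simp
  have bdd: "bdd_above T" by (rule bdd_aboveI[of _ 1]) (auto simp: T_def)
  define s where "s = Sup T"
  have s0: "0 \<le> s" unfolding s_def using T0 bdd by (rule cSup_upper)
  have s1: "s \<le> 1" unfolding s_def
  proof (rule cSup_least)
    show "T \<noteq> {}" using T0 by blast
  qed (simp add: T_def)
  have s: "s = 1"
  proof (rule ccontr)
    assume "s \<noteq> 1"
    hence "s < 1" using s1 by simp
    \<comment> \<open>The parameters \<open>a k\<close> approach \<open>s\<close> from below and \<open>b k\<close> from above. For large \<open>k\<close>, \<open>F\<close> maps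
      the square of \<open>a k\<close> into the interval of \<open>b k\<close>.\<close>
    define a where "a k = max 0 (s - 1 / real (Suc k))" for k
    define b where "b k = s + 1 / real (Suc k)" for k
    have lim: "(\<lambda>k. 1 / real (Suc k)) \<longlonglongrightarrow> 0"
      using LIMSEQ_inverse_real_of_nat by (simp add: inverse_eq_divide)
    have "a \<longlonglongrightarrow> max 0 (s - 0)" unfolding a_def by (intro tendsto_intros lim)
    hence a: "a \<longlonglongrightarrow> s" using s0 by simp
    have "b \<longlonglongrightarrow> s + 0" unfolding b_def by (intro tendsto_intros lim)
    hence b: "b \<longlonglongrightarrow> s" by simp
    have a0: "0 \<le> a k" and b0: "0 \<le> b k" and sb: "s < b k" for k
      using s0 by (auto simp: a_def b_def)
    have \<phi>0: "0 \<le> \<phi> t" if "0 \<le> t" for t using \<phi>_maps that by auto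
    have \<phi>a: "(\<lambda>k. \<phi> (a k)) \<longlonglongrightarrow> \<phi> s"
      using a0 s0 by (intro continuous_on_tendsto_compose[OF cont_\<phi> a]) auto
    have \<phi>b: "(\<lambda>k. \<phi> (b k)) \<longlonglongrightarrow> \<phi> s"
      using b0 s0 by (intro continuous_on_tendsto_compose[OF cont_\<phi> b]) auto
    have low: "(\<lambda>k. F (a k, \<phi> (a k))) \<longlonglongrightarrow> F (s, \<phi> s)"
      using a0 s0 \<phi>0 by (intro continuous_on_tendsto_compose[OF cont_F] tendsto_Pair a \<phi>a) auto
    have up: "(\<lambda>k. F (\<phi> (a k), a k)) \<longlonglongrightarrow> F (\<phi> s, s)"
      using a0 s0 \<phi>0 by (intro continuous_on_tendsto_compose[OF cont_F] tendsto_Pair a \<phi>a) auto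
    have "eventually (\<lambda>k. 0 < F (a k, \<phi> (a k)) - b k) sequentially"
      using lower_corner[OF s0 \<open>s < 1\<close>] by (intro order_tendstoD(1)[OF tendsto_diff[OF low b]]) simp
    moreover have "eventually (\<lambda>k. 0 < \<phi> (b k) - F (\<phi> (a k), a k)) sequentially"
      using upper_corner[OF s0 \<open>s < 1\<close>] by (intro order_tendstoD(1)[OF tendsto_diff[OF \<phi>b up]]) simp
    moreover have "eventually (\<lambda>k. b k < 1) sequentially"
      using \<open>s < 1\<close> by (rule order_tendstoD(2)[OF b])
    ultimately have "eventually (\<lambda>k. b k < F (a k, \<phi> (a k)) \<and> F (\<phi> (a k), a k) < \<phi> (b k) \<and> b k < 1)
        sequentially"
      by eventually_elim simp
    then obtain k where k: "b k < F (a k, \<phi> (a k))" "F (\<phi> (a k), a k) < \<phi> (b k)" "b k < 1"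
      by (auto simp: eventually_sequentially)
    obtain t where t: "t \<in> T" "a k \<le> t"
    proof (cases "a k = 0")
      case True
      thus ?thesis using T0 that by simp
    next
      case False
      hence "a k < s" by (auto simp: a_def max_def split: if_splits)
      hence "\<exists>t\<in>T. a k < t" using T0 bdd less_cSup_iff[of T] unfolding s_def by blast
      thus ?thesis using that by force
    qed
    have t01: "0 \<le> t" and "eventually (\<lambda>n. x n \<in> {t..\<phi> t}) sequentially"
      using t(1) by (auto simp: T_def)
    moreover have "{t..\<phi> t} \<subseteq> {a k..\<phi> (a k)}"
      using monotone_onD[OF anti_\<phi>, of "a k" t] t(2) t01 a0[of k] by auto
    ultimately have ev: "eventually (\<lambda>n. x n \<in> {a k..\<phi> (a k)}) sequentially"
      by (auto elim: eventually_mono)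
    have "eventually (\<lambda>n. x (Suc (Suc n)) \<in> {b k..\<phi> (b k)}) sequentially"
      using ev iffD2[OF eventually_sequentially_Suc[of "\<lambda>n. x n \<in> {a k..\<phi> (a k)}"] ev]
    proof eventually_elim
      case (elim n)
      have nn: "0 \<le> x n" "0 \<le> x (Suc n)" using elim a0[of k] by auto
      have "F (a k, \<phi> (a k)) \<le> x (Suc (Suc n))" "x (Suc (Suc n)) \<le> F (\<phi> (a k), a k)"
        unfolding rec using elim a0[of k] nn by (auto intro!: mono_F)
      thus ?case using k by simp
    qed
    hence "eventually (\<lambda>n. x n \<in> {b k..\<phi> (b k)}) sequentially"
      using eventually_sequentially_Suc[of "\<lambda>n. x n \<in> {b k..\<phi> (b k)}"]
        eventually_sequentially_Suc[of "\<lambda>n. x (Suc n) \<in> {b k..\<phi> (b k)}"] by blast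
    hence "b k \<in> T" using b0 k(3) by (simp add: T_def)
    hence "b k \<le> s" unfolding s_def using bdd by (rule cSup_upper)
    thus False using sb[of k] by simp
  qed
  show ?thesis
  proof (rule LIMSEQ_I)
    fix e :: real assume "0 < e"
    then obtain d where d: "0 < d" "\<And>t. 0 \<le> t \<Longrightarrow> dist t 1 < d \<Longrightarrow> dist (\<phi> t) (\<phi> 1) < e"
      using cont_\<phi> unfolding continuous_on_iff by (metis atLeast_iff zero_le_one)
    have "max (1 - d) (1 - e) < Sup T" using s d(1) \<open>0 < e\<close> by (simp add: s_def)
    then obtain t where t: "t \<in> T" "1 - d < t" "1 - e < t"
      using T0 bdd less_cSup_iff[of T] by (metis empty_iff max_less_iff_conj)
    have "0 \<le> t" "t \<le> 1" and ev: "eventually (\<lambda>n. x n \<in> {t..\<phi> t}) sequentially"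
      using t(1) by (auto simp: T_def)
    hence "\<phi> t < 1 + e" using d(2)[of t] t(2) \<phi>_1 by (auto simp: dist_real_def)
    from ev have "eventually (\<lambda>n. norm (x n - 1) < e) sequentially"
      by eventually_elim (use \<open>\<phi> t < 1 + e\<close> t(3) in auto)
    thus "\<exists>N. \<forall>n\<ge>N. norm (x n - 1) < e" by (simp add: eventually_sequentially)
  qed
qed

text \<open>
  A solution above \<open>c\<close> would be decreasing and bounded below, so its limit would be a fixed point
  \<open>u \<ge> c\<close> of \<open>F\<close>.
\<close>

lemma solution_enters_box:
  fixes F :: "real \<times> real \<Rightarrow> real" and x :: "nat \<Rightarrow> real"
  assumes cont_F: "continuous_on (\<I> \<times> \<I>) F" and "0 \<le> c"
    and rec: "\<And>n. x (Suc (Suc n)) = F (x (Suc n), x n)"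
    and decr: "\<And>u v. c < u \<Longrightarrow> c < v \<Longrightarrow> F (u, v) \<le> u"
    and no_fix: "\<And>u. c \<le> u \<Longrightarrow> F (u, u) \<noteq> u"
  shows "\<exists>n. x n \<le> c"
proof (rule ccontr)
  assume "\<nexists>n. x n \<le> c"
  hence above: "c < x n" for n by (simp add: not_le)
  have "decseq (\<lambda>n. x (Suc n))"
    unfolding decseq_Suc_iff rec by (intro allI decr above)
  then obtain l where l1: "(\<lambda>n. x (Suc n)) \<longlonglongrightarrow> l"
    using above by (metis decseq_convergent less_imp_le)
  hence l0: "x \<longlonglongrightarrow> l" by (rule LIMSEQ_imp_Suc)
  have cl: "c \<le> l" using above by (intro LIMSEQ_le_const[OF l0]) (auto intro: less_imp_le)
  have "0 \<le> x n" for n using above[of n] \<open>0 \<le> c\<close> by simp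
  hence "(\<lambda>n. F (x (Suc n), x n)) \<longlonglongrightarrow> F (l, l)"
    using cl \<open>0 \<le> c\<close> by (intro continuous_on_tendsto_compose[OF cont_F] tendsto_Pair l0 l1) auto
  moreover have "(\<lambda>n. F (x (Suc n), x n)) \<longlonglongrightarrow> l"
    using LIMSEQ_Suc[OF l1] by (simp add: rec)
  ultimately have "F (l, l) = l" by (rule LIMSEQ_unique)
  thus False using no_fix[OF cl] by simp
qed

theorem theorem4p11:
  fixes F :: "real \<times> real \<Rightarrow> real" and \<phi> :: "real \<Rightarrow> real"
  assumes F_maps: "F \<in> \<I> \<times> \<I> \<rightarrow> \<I>"
    and F_smooth: "C1_on F (\<I> \<times> \<I>)"
    and F_inc: "\<And>y. y \<in> \<I> \<Longrightarrow> strict_mono_on \<I> (\<lambda>x. F (x, y))"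
    and F_dec: "\<And>x. x \<in> \<I> \<Longrightarrow> strict_antimono_on \<I> (\<lambda>y. F (x, y))"
    and unique_intersection:
      "{(x, y). 0 < x \<and> 0 < y \<and> y = F (x, y) \<and> x = F (x, y)} = {(1, 1)}"
    and unique_fixed_point: "{x \<in> \<I>. F (x, x) = x} = {1}"
    and strongly_LAS: "grad_norm1 F (1, 1) < 1"
    and phi_maps: "\<phi> \<in> \<I> \<rightarrow> \<I>"
    and phi_dec: "strict_antimono_on \<I> \<phi>"
    and phi_diff: "\<phi> differentiable_on \<I>"
    and phi_region: "\<And>x. x \<in> \<I> \<Longrightarrow> (x, \<phi> x) \<in> region F"
    and phi_LAS: "LAS_1d \<phi> 1"
    and phi_inv_region: "\<And>x. x \<in> \<phi> ` \<I> \<Longrightarrow> (x, inv_into \<I> \<phi> x) \<in> region F"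
    and no_2_cycle: "\<not> has_2_cycle (\<lambda>x. F (\<phi> x, x))"
  shows "GAS F 1"
proof -
  have fix1: "F (1, 1) = 1" and fix_unique: "\<And>u. 0 \<le> u \<Longrightarrow> F (u, u) = u \<Longrightarrow> u = 1"
    using unique_fixed_point by auto
  have \<phi>_1: "\<phi> 1 = 1" using phi_LAS by (simp add: LAS_1d_def)
  have \<phi>_nonneg: "0 \<le> \<phi> t" if "0 \<le> t" for t using phi_maps that by auto
  have \<phi>_less: "\<phi> v < \<phi> u" if "0 \<le> u" "u < v" for u v
    using monotone_onD[OF phi_dec, of u v] that by simp
  have anti_\<phi>: "antimono_on \<I> \<phi>"
    by (rule monotone_onI) (metis \<phi>_less atLeast_iff less_eq_real_def)
  have cont_\<phi>: "continuous_on \<I> \<phi>"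
    using phi_diff by (rule differentiable_imp_continuous_on)
  have cont_F: "continuous_on (\<I> \<times> \<I>) F"
    using F_smooth by (rule C1_on_imp_continuous_on)
  have mono_F: "F (u, v) \<le> F (u', v')" if "0 \<le> u" "u \<le> u'" "0 \<le> v'" "v' \<le> v" for u u' v v'
  proof -
    have "F (u, v) \<le> F (u', v)"
      using monotone_onD[OF F_inc, of v u u'] that by (cases "u = u'") auto
    also have "\<dots> \<le> F (u', v')"
      using monotone_onD[OF F_dec, of u' v' v] that by (cases "v = v'") auto
    finally show ?thesis .
  qed
  have corner: "min t (\<phi> t) < F (t, \<phi> t) \<and> F (t, \<phi> t) < max t (\<phi> t)"
    if "0 \<le> t" "t \<noteq> 1" for t
    using phi_region[of t] that by (auto simp: region_def)
  \<comment> \<open>At \<open>x = \<phi> t\<close>, the hypothesis on \<open>\<phi>\<^sup>-\<^sup>1\<close> is about the reflected point \<open>(\<phi> t, t)\<close>.\<close>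
  have corner': "min t (\<phi> t) < F (\<phi> t, t) \<and> F (\<phi> t, t) < max t (\<phi> t)"
    if "0 \<le> t" "t \<noteq> 1" for t
  proof -
    have "inj_on \<phi> \<I>"
      by (rule linorder_inj_onI) (use \<phi>_less in fastforce)+
    hence "inv_into \<I> \<phi> (\<phi> t) = t" using that by simp
    thus ?thesis
      using phi_inv_region[of "\<phi> t"] that by (auto simp: region_def min.commute max.commute)
  qed
  have lower: "t < F (t, \<phi> t)" and upper: "F (\<phi> t, t) < \<phi> t" if "0 \<le> t" "t < 1" for t
    using corner[of t] corner'[of t] \<phi>_less[of t 1] \<phi>_1 that by auto
  have c1: "1 < \<phi> 0" using \<phi>_less[of 0 1] \<phi>_1 by simp
  have "x \<longlonglongrightarrow> 1" if sol: "is_solution F x" for x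
  proof -
    have rec: "x (Suc (Suc n)) = F (x (Suc n), x n)" for n
      using sol by (simp add: is_solution_def)
    have nonneg: "0 \<le> x n" for n by (rule is_solution_nonneg[OF F_maps sol])
    have decr: "F (u, v) \<le> u" if "\<phi> 0 < u" "\<phi> 0 < v" for u v
    proof -
      have "1 < u" "1 < v" using that c1 by auto
      hence "\<phi> u < 1" using \<phi>_less[of 1 u] \<phi>_1 by simp
      hence "F (u, v) \<le> F (u, \<phi> u)"
        using \<open>1 < u\<close> \<open>1 < v\<close> \<phi>_nonneg[of u] by (intro mono_F) auto
      also have "\<dots> < u" using corner[of u] \<open>1 < u\<close> \<open>\<phi> u < 1\<close> by auto
      finally show ?thesis by simp
    qed
    have no_fix: "F (u, u) \<noteq> u" if "\<phi> 0 \<le> u" for u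
      using fix_unique[of u] that c1 by auto
    \<comment> \<open>A term in \<open>[0, \<phi> 0]\<close> is wanted at a positive index, because \<open>x 1\<close> is an arbitrary
      initial condition that \<open>x 0\<close> does not bound.\<close>
    have "\<exists>m. x (Suc m) \<le> \<phi> 0"
      by (rule solution_enters_box[of F "\<phi> 0" "\<lambda>n. x (Suc n)"])
        (use cont_F c1 rec decr no_fix in auto)
    then obtain m where m: "x (Suc m) \<le> \<phi> 0" by blast
    have bound_persists: "x (Suc (Suc n)) \<le> \<phi> 0" if "x (Suc n) \<le> \<phi> 0" for n
    proof -
      have "x (Suc (Suc n)) \<le> F (\<phi> 0, 0)"
        unfolding rec using that nonneg by (intro mono_F) auto
      thus ?thesis using upper[of 0] by simp
    qed
    have "x n \<le> \<phi> 0" if "Suc m \<le> n" for n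
      using that
    proof (induction rule: dec_induct)
      case (step n)
      then obtain k where "n = Suc k" by (cases n) auto
      thus ?case using \<open>x n \<le> \<phi> 0\<close> bound_persists by simp
    qed (rule m)
    hence "eventually (\<lambda>n. x n \<in> {0..\<phi> 0}) sequentially"
      using nonneg by (auto simp: eventually_sequentially)
    thus ?thesis
      by (intro nested_boxes_tendsto[of F \<phi> x])
        (use cont_F mono_F cont_\<phi> phi_maps anti_\<phi> \<phi>_1 lower upper rec in auto)
  qed
  with LAS_if_grad_norm1[OF fix1 strongly_LAS] show ?thesis
    unfolding GAS_def by blast
qed

end
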